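(* Let $m\in\{1,2,3,4\}$, let $n>1$ be an integer, let $a_1,\dots,a_5,b_1,\dots,b_{12}\in\mathbb{R}$, and let $I=[0,T]$ with $T>0$. Consider the perturbed R-KdV-RLW equation $$v_t+a_1v_x+a_2v_{xxx}+a_3v_{xxt}+a_4v_{xxxxt}+a_5(v^n)_x=R,$$ where $$\begin{aligned}R={}&b_1v+b_2v_{xx}+b_3v_xv_{xx}+b_4v^mv_x+b_5vv_{xxx}+b_6vv_xv_{xx}+b_7v_x^3\\&+b_8v_xv_{xxxx}+b_9v_{xx}v_{xxx}+b_{10}v_{xxxx}+b_{11}v_{xxxxx}+b_{12}vv_{xxxxx}.\end{aligned}$$ Suppose $b_1^2+b_2^2+b_{10}^2\neq0$, and assume that the equation admits at most one classical solution $v:I\times\mathbb{R}\to\mathbb{R}$ for given initial data $v_0=v(0,x)$. Then any non-trivial bounded classical symmetric traveling solution is a finite linear combination of functions of trigonometric type. As a consequence, there exists no non-trivial symmetric traveling solution of solitary type. Moreover, a non-trivial bounded classical symmetric steady solution exists only when the coefficients satisfy one of the following: (i) $b_1=0$ and $b_2b_{10}>0$; (ii) $b_2^2>4b_1b_{10}$, $b_1<0$ and $b_{10}>0$; (iii) $b_2^2>4b_1b_{10}$ and $\big(\sqrt{b_2^2-4b_1b_{10}}-b_2\big)b_{10}<0$; (iv) $b_2^2=4b_1b_{10}$ and $b_2b_{10}>0$; (v) $b_{10}=0$, $b_2\neq0$ and $b_1b_2>0$.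
   Context: A classical solution is a function all of whose derivatives appearing in the equation exist and are continuous and which satisfies the equation pointwise on $I\times\mathbb{R}$. A function $f(t,x)$ on $I\times\mathbb{R}$ is (spatially) symmetric if there exists $\lambda\in C^1(\mathbb{R})$ such that $f(t,x)=f(t,2\lambda(t)-x)$ for every $(t,x)\in I\times\mathbb{R}$. It is steady, equivalently traveling, if $f(t,x)=g(x-ct)$ on $I\times\mathbb{R}$ for some function $g$ (the profile) and some $c\in\mathbb{R}$. "Non-trivial" means not constant. "Finite linear combination of functions of trigonometric type" means that the profile $g(y)$, $y=x-ct$, is a finite real linear combination of functions $\cos(\omega y)$ and $\sin(\omega y)$ with real frequencies $\omega\ge0$ (the value $\omega=0$ accounting for an additive constant). A traveling solution is of solitary type if its profile satisfies $g(y)\to0$ as $|y|\to\infty$. *)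

theory Defs
  imports "HOL-Analysis.Analysis"
begin

text \<open>
  A function on \<open>I \<times> \<real>\<close> is a curried total function \<open>u t x\<close>; every notion below depends only on
  its values at \<open>t \<in> I\<close>. Time derivatives are taken within \<open>I\<close>, hence are one-sided at the
  endpoints of \<open>I = [0,T]\<close>.
\<close>

definition dx :: "nat \<Rightarrow> (real \<Rightarrow> real \<Rightarrow> real) \<Rightarrow> real \<Rightarrow> real \<Rightarrow> real" where
  "dx k u t x = (deriv ^^ k) (u t) x"

definition dt :: "real set \<Rightarrow> (real \<Rightarrow> real \<Rightarrow> real) \<Rightarrow> real \<Rightarrow> real \<Rightarrow> real" where
  "dt I u t x = vector_derivative (\<lambda>s. u s x) (at t within I)"

definition has_dx :: "real set \<Rightarrow> nat \<Rightarrow> (real \<Rightarrow> real \<Rightarrow> real) \<Rightarrow> bool" where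
  "has_dx I k u \<longleftrightarrow> (\<forall>t\<in>I. \<forall>j<k. \<forall>x. dx j u t differentiable (at x))"

definition has_dt :: "real set \<Rightarrow> (real \<Rightarrow> real \<Rightarrow> real) \<Rightarrow> bool" where
  "has_dt I u \<longleftrightarrow> (\<forall>t\<in>I. \<forall>x. (\<lambda>s. u s x) differentiable (at t within I))"

definition has_continuous_dx :: "real set \<Rightarrow> nat \<Rightarrow> (real \<Rightarrow> real \<Rightarrow> real) \<Rightarrow> bool" where
  "has_continuous_dx I k u \<longleftrightarrow>
     has_dx I k u \<and> continuous_on (I \<times> UNIV) (\<lambda>(t, x). dx k u t x)"

text \<open>The mixed derivative \<open>\<partial>\<^sub>t \<partial>\<^sub>x\<^sup>k u\<close>, that is \<open>u\<^sub>t\<close>, \<open>u\<^sub>x\<^sub>x\<^sub>t\<close>, \<open>u\<^sub>x\<^sub>x\<^sub>x\<^sub>x\<^sub>t\<close> for \<open>k = 0, 2, 4\<close>.\<close>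

definition has_continuous_dxt :: "real set \<Rightarrow> nat \<Rightarrow> (real \<Rightarrow> real \<Rightarrow> real) \<Rightarrow> bool" where
  "has_continuous_dxt I k u \<longleftrightarrow>
     has_dx I k u \<and> has_dt I (dx k u) \<and> continuous_on (I \<times> UNIV) (\<lambda>(t, x). dt I (dx k u) t x)"

text \<open>
  The coefficients \<open>a\<^sub>1, \<dots>, a\<^sub>5\<close> and \<open>b\<^sub>1, \<dots>, b\<^sub>1\<^sub>2\<close> are the values \<open>a 1, \<dots>, a 5\<close> and
  \<open>b 1, \<dots>, b 12\<close>; no other values are used.
\<close>

definition perturbation ::
  "nat \<Rightarrow> (nat \<Rightarrow> real) \<Rightarrow> (real \<Rightarrow> real \<Rightarrow> real) \<Rightarrow> real \<Rightarrow> real \<Rightarrow> real" where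
  "perturbation m b v t x =
     b 1 * v t x + b 2 * dx 2 v t x + b 3 * dx 1 v t x * dx 2 v t x
     + b 4 * v t x ^ m * dx 1 v t x + b 5 * v t x * dx 3 v t x
     + b 6 * v t x * dx 1 v t x * dx 2 v t x + b 7 * dx 1 v t x ^ 3
     + b 8 * dx 1 v t x * dx 4 v t x + b 9 * dx 2 v t x * dx 3 v t x
     + b 10 * dx 4 v t x + b 11 * dx 5 v t x + b 12 * v t x * dx 5 v t x"

definition satisfies_rkdv_rlw ::
  "real set \<Rightarrow> nat \<Rightarrow> nat \<Rightarrow> (nat \<Rightarrow> real) \<Rightarrow> (nat \<Rightarrow> real) \<Rightarrow> (real \<Rightarrow> real \<Rightarrow> real) \<Rightarrow> bool" where
  "satisfies_rkdv_rlw I m n a b v \<longleftrightarrow>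
     (\<forall>t\<in>I. \<forall>x.
        dt I v t x + a 1 * dx 1 v t x + a 2 * dx 3 v t x
        + a 3 * dt I (dx 2 v) t x + a 4 * dt I (dx 4 v) t x
        + a 5 * dx 1 (\<lambda>s y. v s y ^ n) t x
        = perturbation m b v t x)"

text \<open>
  A derivative appears in the equation if it occurs in a term with non-zero coefficient; the term
  \<open>(v\<^sup>n)\<^sub>x\<close> counts as an occurrence of \<open>v\<^sub>x\<close>. Terms with zero coefficient vanish
  identically and so impose no regularity.
\<close>

definition appearing_regularity ::
  "real set \<Rightarrow> (nat \<Rightarrow> real) \<Rightarrow> (nat \<Rightarrow> real) \<Rightarrow> (real \<Rightarrow> real \<Rightarrow> real) \<Rightarrow> bool" where
  "appearing_regularity I a b v \<longleftrightarrow>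
     has_continuous_dxt I 0 v \<and>
     (a 3 \<noteq> 0 \<longrightarrow> has_continuous_dxt I 2 v) \<and>
     (a 4 \<noteq> 0 \<longrightarrow> has_continuous_dxt I 4 v) \<and>
     ((\<exists>i\<in>{1, 5}. a i \<noteq> 0) \<or> (\<exists>i\<in>{3, 4, 6, 7, 8}. b i \<noteq> 0) \<longrightarrow> has_continuous_dx I 1 v) \<and>
     ((\<exists>i\<in>{2, 3, 6, 9}. b i \<noteq> 0) \<longrightarrow> has_continuous_dx I 2 v) \<and>
     (a 2 \<noteq> 0 \<or> (\<exists>i\<in>{5, 9}. b i \<noteq> 0) \<longrightarrow> has_continuous_dx I 3 v) \<and>
     ((\<exists>i\<in>{8, 10}. b i \<noteq> 0) \<longrightarrow> has_continuous_dx I 4 v) \<and>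
     ((\<exists>i\<in>{11, 12}. b i \<noteq> 0) \<longrightarrow> has_continuous_dx I 5 v)"

definition classical_solution ::
  "real set \<Rightarrow> nat \<Rightarrow> nat \<Rightarrow> (nat \<Rightarrow> real) \<Rightarrow> (nat \<Rightarrow> real) \<Rightarrow> (real \<Rightarrow> real \<Rightarrow> real) \<Rightarrow> bool" where
  "classical_solution I m n a b v \<longleftrightarrow>
     appearing_regularity I a b v \<and> satisfies_rkdv_rlw I m n a b v"

definition at_most_one_classical_solution ::
  "real \<Rightarrow> nat \<Rightarrow> nat \<Rightarrow> (nat \<Rightarrow> real) \<Rightarrow> (nat \<Rightarrow> real) \<Rightarrow> bool" where
  "at_most_one_classical_solution T m n a b \<longleftrightarrow>
     (\<forall>v w. classical_solution {0..T} m n a b v \<and> classical_solution {0..T} m n a b w \<and>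
            (\<forall>x. v 0 x = w 0 x) \<longrightarrow>
            (\<forall>t\<in>{0..T}. \<forall>x. v t x = w t x))"

definition spatially_symmetric :: "real set \<Rightarrow> (real \<Rightarrow> real \<Rightarrow> real) \<Rightarrow> bool" where
  "spatially_symmetric I f \<longleftrightarrow>
     (\<exists>l. l C1_differentiable_on UNIV \<and> (\<forall>t\<in>I. \<forall>x. f t x = f t (2 * l t - x)))"

definition travels_with ::
  "real set \<Rightarrow> (real \<Rightarrow> real \<Rightarrow> real) \<Rightarrow> (real \<Rightarrow> real) \<Rightarrow> real \<Rightarrow> bool" where
  "travels_with I f g c \<longleftrightarrow> (\<forall>t\<in>I. \<forall>x. f t x = g (x - c * t))"

definition steady :: "real set \<Rightarrow> (real \<Rightarrow> real \<Rightarrow> real) \<Rightarrow> bool" where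
  "steady I f \<longleftrightarrow> (\<exists>g c. travels_with I f g c)"

definition solitary_type :: "real set \<Rightarrow> (real \<Rightarrow> real \<Rightarrow> real) \<Rightarrow> bool" where
  "solitary_type I f \<longleftrightarrow> (\<exists>g c. travels_with I f g c \<and> (g \<longlongrightarrow> 0) at_infinity)"

definition nontrivial :: "real set \<Rightarrow> (real \<Rightarrow> real \<Rightarrow> real) \<Rightarrow> bool" where
  "nontrivial I f \<longleftrightarrow> \<not> (\<lambda>(t, x). f t x) constant_on (I \<times> UNIV)"

definition bounded_function :: "real set \<Rightarrow> (real \<Rightarrow> real \<Rightarrow> real) \<Rightarrow> bool" where
  "bounded_function I f \<longleftrightarrow> bounded ((\<lambda>(t, x). f t x) ` (I \<times> UNIV))"

definition trigonometric_combination :: "(real \<Rightarrow> real) \<Rightarrow> bool" where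
  "trigonometric_combination g \<longleftrightarrow>
     (\<exists>W \<alpha> \<beta>. finite W \<and> (\<forall>\<omega>\<in>W. 0 \<le> \<omega>) \<and>
        (\<forall>y. g y = (\<Sum>\<omega>\<in>W. \<alpha> \<omega> * cos (\<omega> * y) + \<beta> \<omega> * sin (\<omega> * y))))"

end

theory Submission
  imports Defs
begin

text \<open>
  Evaluate the equation for \<open>v(t,x) = g(x - ct)\<close> at the interior time \<open>t = T / 2\<close>, where \<open>g\<close> is
  even about some axis. Under reflection in this axis the terms with coefficients
  \<open>b\<^sub>1, b\<^sub>2, b\<^sub>1\<^sub>0\<close> are even and all others are odd, so that
  \<open>b\<^sub>1 g + b\<^sub>2 g'' + b\<^sub>1\<^sub>0 g'''' = 0\<close>. An even solution of this linear equation
  is a combination of two functions \<open>cosh (r y)\<close> with \<open>r\<close> complex and \<open>r\<^sup>2\<close> a root of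
  \<open>b\<^sub>1\<^sub>0 s\<^sup>2 + b\<^sub>2 s + b\<^sub>1\<close> (plus a resonant term \<open>y sinh (r y)\<close> at a double root);
  boundedness leaves only the modes with \<open>r\<close> imaginary. A non-constant bounded profile thus
  forces a negative root \<open>s\<close>, which is what the conditions on the coefficients express.
\<close>

section \<open>Complex hyperbolic modes and their addition formulas\<close>

text \<open>The solution of \<open>u'' = r\<^sup>2 u\<close> with \<open>u 0 = 1\<close> and
  \<open>u' 0 = 0\<close>. A complex \<open>r\<close> covers hyperbolic cosines, cosines and
  constants at once.\<close>

definition ch :: "complex \<Rightarrow> real \<Rightarrow> complex" where
  "ch r y = cosh (r * of_real y)"

text \<open>The primitive of \<^term>\<open>ch r\<close> vanishing at \<open>0\<close>, also for \<open>r = 0\<close>.\<close>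

definition sh :: "complex \<Rightarrow> real \<Rightarrow> complex" where
  "sh r y = (if r = 0 then of_real y else sinh (r * of_real y) / r)"

lemma ch_0 [simp]: "ch r 0 = 1" and sh_0 [simp]: "sh r 0 = 0"
  and ch_minus [simp]: "ch r (- y) = ch r y" and sh_minus [simp]: "sh r (- y) = - sh r y"
  by (simp_all add: ch_def sh_def)

text \<open>The factor \<open>r\<^sup>2\<close> compensates for the division by \<open>r\<close> in
  \<open>sh\<close>, so the formula includes \<open>r = 0\<close>.\<close>

lemma ch_add: "ch r (x + y) = ch r x * ch r y + r\<^sup>2 * sh r x * sh r y"
  by (simp add: ch_def sh_def distrib_left cosh_add power2_eq_square)

lemma sh_add: "sh r (x + y) = sh r x * ch r y + ch r x * sh r y"
  by (simp add: ch_def sh_def distrib_left sinh_add add_divide_distrib)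

lemma ch_diff: "ch r (x - y) = ch r x * ch r y - r\<^sup>2 * sh r x * sh r y"
  using ch_add[of r x "- y"] by simp

lemma sh_diff: "sh r (x - y) = sh r x * ch r y - ch r x * sh r y"
  using sh_add[of r x "- y"] by simp

lemma ch_has_vector_derivative [derivative_intros]:
  "(ch r has_vector_derivative r\<^sup>2 * sh r y) (at y within S)"
proof -
  have "((\<lambda>z. cosh (r * z)) has_field_derivative r * sinh (r * of_real y)) (at (of_real y))"
    by (auto intro!: derivative_eq_intros)
  from field_vector_diff_chain_at[OF has_vector_derivative_of_real[OF DERIV_ident] this]
  have "(ch r has_vector_derivative r * sinh (r * of_real y)) (at y)"
    by (simp add: o_def ch_def[abs_def])
  then show ?thesis
    by (auto simp: sh_def power2_eq_square intro: has_vector_derivative_at_within)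
qed

lemma sh_has_vector_derivative [derivative_intros]:
  "(sh r has_vector_derivative ch r y) (at y within S)"
proof (cases "r = 0")
  case True
  then show ?thesis
    by (auto simp: sh_def[abs_def] ch_def intro!: derivative_eq_intros)
next
  case False
  have "((\<lambda>z. sinh (r * z) / r) has_field_derivative cosh (r * of_real y)) (at (of_real y))"
    using False by (auto intro!: derivative_eq_intros)
  from field_vector_diff_chain_at[OF has_vector_derivative_of_real[OF DERIV_ident] this]
  have "(sh r has_vector_derivative ch r y) (at y)"
    using False by (simp add: o_def ch_def sh_def[abs_def])
  then show ?thesis
    by (rule has_vector_derivative_at_within)
qed

text \<open>The derivative of \<open>sh r\<close> at \<open>0\<close> is
  \<open>ch r 0 = 1\<close>.\<close>

lemma sh_not_identically_0: obtains t where "sh r t \<noteq> 0"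
proof -
  have False if "\<And>t. sh r t = 0"
  proof -
    have "sh r = (\<lambda>_. 0)"
      using that by auto
    then have "((\<lambda>_. 0) has_vector_derivative ch r 0) (at 0)"
      using sh_has_vector_derivative by metis
    from vector_derivative_unique_at[OF this has_vector_derivative_const]
    show False by simp
  qed
  then show ?thesis using that by blast
qed

text \<open>The second derivative of \<open>ch r\<close> at \<open>0\<close> is
  \<open>r\<^sup>2\<close>, so equal modes have equal squared rates.\<close>

lemma ch_separates:
  assumes "r\<^sup>2 \<noteq> q\<^sup>2"
  obtains t where "ch r t \<noteq> ch q t"
proof -
  have False if "\<And>t. ch r t = ch q t"
  proof -
    have eq: "ch r = ch q"
      using that by auto
    have "(\<lambda>y. r\<^sup>2 * sh r y) = (\<lambda>y. q\<^sup>2 * sh q y)"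
      using vector_derivative_unique_at[OF ch_has_vector_derivative[of r]]
        ch_has_vector_derivative[of q] unfolding eq by blast
    moreover have d: "((\<lambda>y. p\<^sup>2 * sh p y) has_vector_derivative p\<^sup>2 * ch p 0) (at 0)" for p
      by (auto intro!: derivative_eq_intros)
    ultimately have "((\<lambda>y. r\<^sup>2 * sh r y) has_vector_derivative q\<^sup>2 * ch q 0) (at 0)"
      by simp
    from vector_derivative_unique_at[OF this d[of r]]
    show False using assms by simp
  qed
  then show ?thesis using that by blast
qed

section \<open>Decay and boundedness of combinations of modes\<close>

text \<open>By the duplication formula a limit \<open>L\<close> satisfies
  \<open>L = 2 * L\<^sup>2 - 1\<close>, which excludes \<open>0\<close>.\<close>

lemma ch_not_tendsto_0: "\<not> (ch r \<longlongrightarrow> 0) at_top"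
proof
  assume lim: "(ch r \<longlongrightarrow> 0) at_top"
  have double: "ch r (2 * y) = 2 * (ch r y)\<^sup>2 - 1" for y
    using cosh_double_cosh[of "r * of_real y"] by (simp add: ch_def ac_simps)
  have "((\<lambda>y. 2 * (ch r y)\<^sup>2 - 1) \<longlongrightarrow> 2 * 0\<^sup>2 - 1) at_top"
    by (intro tendsto_intros lim)
  moreover have "((\<lambda>y. ch r (2 * y)) \<longlongrightarrow> 0) at_top"
    by (rule filterlim_compose[OF lim])
      (simp add: filterlim_tendsto_pos_mult_at_top[OF tendsto_const] filterlim_ident)
  ultimately show False
    unfolding double by (auto dest: tendsto_unique[rotated])
qed

lemma tendsto_at_top_shift:
  fixes f :: "real \<Rightarrow> 'a::topological_space"
  assumes "(f \<longlongrightarrow> l) at_top"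
  shows "((\<lambda>y. f (y + s)) \<longlongrightarrow> l) at_top"
  by (rule filterlim_compose[OF assms])
    (simp add: add.commute[of _ s] filterlim_tendsto_add_at_top[OF tendsto_const] filterlim_ident)

lemma bounded_ch_imp_Re_0:
  assumes "bounded (range (ch r))"
  shows "Re r = 0"
proof (rule ccontr)
  assume nz: "Re r \<noteq> 0"
  from assms obtain B where B: "\<And>y. norm (ch r y) \<le> B"
    by (auto simp: bounded_iff)
  \<comment> \<open>Here one of the two exponentials in \<open>cosh\<close> has norm
    \<open>exp (2 * B + 2)\<close>, while the bound on \<open>ch r y\<close> allows only
    \<open>2 * B + 1\<close>.\<close>
  define y where "y = (2 * B + 2) / Re r"
  have "0 \<le> B" using B[of 0] norm_ge_zero order_trans by blast
  have y: "Re r * y = 2 * B + 2" using nz by (simp add: y_def)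
  have "exp (r * of_real y) = 2 * ch r y - exp (- (r * of_real y))"
    by (simp add: ch_def cosh_field_def field_simps)
  then have "norm (exp (r * of_real y)) \<le> norm (2 * ch r y) + norm (exp (- (r * of_real y)))"
    by (metis norm_triangle_ineq4)
  also have "\<dots> \<le> 2 * B + 1"
  proof -
    have "exp (- (2 * B + 2)) \<le> 1"
      using \<open>0 \<le> B\<close> by simp
    moreover have "norm (2 * ch r y) = 2 * norm (ch r y)"
      "norm (exp (- (r * of_real y))) = exp (- (2 * B + 2))"
      by (simp_all add: norm_mult y)
    ultimately show ?thesis
      using B[of y] by linarith
  qed
  finally have "exp (2 * B + 2) \<le> 2 * B + 1"
    by (simp add: y)
  with exp_ge_add_one_self[of "2 * B + 2"] show False by simp
qed

text \<open>Averaging over shifts by \<open>\<plusminus> t\<close> multiplies \<^term>\<open>ch q\<close> by \<^term>\<open>2 * ch q t\<close>, so it can be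
  used to eliminate one mode.\<close>

lemma eliminate_mode:
  assumes "r\<^sup>2 \<noteq> q\<^sup>2" and "\<And>y. f y = A * ch r y + B * ch q y"
  obtains t k where "k \<noteq> 0" and "\<And>y. f (y + t) + f (y - t) - (2 * ch q t) * f y = (k * A) * ch r y"
proof -
  obtain t where t: "ch r t \<noteq> ch q t"
    using ch_separates[OF assms(1)] .
  show ?thesis
    by (rule that[of "2 * (ch r t - ch q t)" t])
      (use t in \<open>simp_all add: assms(2) ch_add ch_diff algebra_simps\<close>)
qed

lemma bounded_shift_combination:
  fixes f :: "real \<Rightarrow> complex"
  assumes "bounded (range f)"
  shows "bounded (range (\<lambda>y. f (y + t) + f (y - t) - c * f y))"
proof -
  from assms obtain B where B: "\<And>y. norm (f y) \<le> B"
    by (auto simp: bounded_iff)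
  have "norm (f (y + t) + f (y - t) - c * f y) \<le> B + B + norm c * B" for y
  proof -
    have "norm (f (y + t) + f (y - t) - c * f y)
        \<le> norm (f (y + t)) + norm (f (y - t)) + norm (c * f y)"
      by (intro norm_triangle_le_diff add_right_mono norm_triangle_ineq)
    also have "\<dots> \<le> B + B + norm c * B"
      unfolding norm_mult by (intro add_mono mult_left_mono B norm_ge_zero)
    finally show ?thesis .
  qed
  then show ?thesis by (auto simp: bounded_iff)
qed

lemma bounded_range_scale_cancel:
  fixes f :: "real \<Rightarrow> complex"
  assumes "bounded (range (\<lambda>y. k * f y))" and "k \<noteq> 0"
  shows "bounded (range f)"
proof -
  from assms(1) obtain B where B: "\<And>y. norm (k * f y) \<le> B"
    by (auto simp: bounded_iff)
  then have "norm (f y) \<le> B / norm k" for y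
    using assms(2) by (simp add: norm_mult field_simps)
  then show ?thesis by (auto simp: bounded_iff)
qed

text \<open>Eliminating the second mode preserves boundedness, so \<open>ch r\<close> alone is
  bounded.\<close>

lemma bounded_two_modes:
  assumes "r\<^sup>2 \<noteq> q\<^sup>2" and "\<And>y. f y = A * ch r y + B * ch q y"
    and "bounded (range f)" and "A \<noteq> 0"
  shows "Re r = 0"
proof -
  obtain t k where k: "k \<noteq> 0"
    and *: "\<And>y. f (y + t) + f (y - t) - (2 * ch q t) * f y = (k * A) * ch r y"
    using eliminate_mode[OF assms(1,2)] by blast
  have "bounded (range (\<lambda>y. (k * A) * ch r y))"
    using bounded_shift_combination[OF assms(3), of t "2 * ch q t"] unfolding * .
  with k assms(4) show ?thesis
    by (intro bounded_ch_imp_Re_0 bounded_range_scale_cancel[of "k * A" "ch r"]) auto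
qed

text \<open>Eliminating the second mode preserves the limit \<open>0\<close>, which
  \<open>ch r\<close> cannot have.\<close>

lemma tendsto_0_two_modes:
  assumes "r\<^sup>2 \<noteq> q\<^sup>2" and "\<And>y. f y = A * ch r y + B * ch q y" and "(f \<longlongrightarrow> 0) at_top"
  shows "A = 0"
proof (rule ccontr)
  assume "A \<noteq> 0"
  obtain t k where k: "k \<noteq> 0"
    and *: "\<And>y. f (y + t) + f (y - t) - (2 * ch q t) * f y = (k * A) * ch r y"
    using eliminate_mode[OF assms(1,2)] by blast
  have "((\<lambda>y. (f (y + t) + f (y + - t) - 2 * ch q t * f y) / (k * A))
      \<longlongrightarrow> (0 + 0 - 2 * ch q t * 0) / (k * A)) at_top"
    using k \<open>A \<noteq> 0\<close> by (intro tendsto_intros tendsto_at_top_shift assms(3)) auto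
  moreover have "(f (y + t) + f (y + - t) - 2 * ch q t * f y) / (k * A) = ch r y" for y
    using *[of y] k \<open>A \<noteq> 0\<close> by simp
  ultimately show False
    using ch_not_tendsto_0 by simp
qed

text \<open>A resonant term would make \<open>ch r\<close> bounded as well. Then
  \<open>y * sh r y\<close> is bounded, so \<open>sh r\<close> decays, and the addition formula
  forces \<open>ch r\<close> to decay.\<close>

lemma bounded_resonant_mode:
  assumes f: "\<And>y. f y = A * ch r y + K * (of_real y * sh r y)" and "bounded (range f)"
  shows "K = 0"
proof (rule ccontr)
  assume K: "K \<noteq> 0"
  obtain t where t: "sh r t \<noteq> 0"
    using sh_not_identically_0 .
  with K have t0: "t \<noteq> 0" by auto
  \<comment> \<open>The shift combination annihilates \<open>ch r\<close> itself and turns the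
    resonant term into a multiple of \<open>ch r\<close>.\<close>
  have "f (y + t) + f (y - t) - 2 * ch r t * f y = (2 * K * of_real t * sh r t) * ch r y" for y
    by (simp add: f ch_add ch_diff sh_add sh_diff algebra_simps)
  then have "bounded (range (\<lambda>y. (2 * K * of_real t * sh r t) * ch r y))"
    using bounded_shift_combination[OF assms(2), of t "2 * ch r t"] by simp
  then have "bounded (range (ch r))"
    using K t t0 by (intro bounded_range_scale_cancel[of "2 * K * of_real t * sh r t" "ch r"]) auto
  then obtain B where B: "\<And>y. norm (ch r y) \<le> B"
    by (auto simp: bounded_iff)
  obtain C where C: "\<And>y. norm (f y) \<le> C"
    using assms(2) by (auto simp: bounded_iff)
  define D where "D = (C + norm A * B) / norm K"
  have "norm (sh r y) \<le> D / y" if "y > 0" for y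
  proof -
    have "norm (K * (of_real y * sh r y)) = norm (f y - A * ch r y)"
      by (simp add: f)
    also have "\<dots> \<le> C + norm A * B"
      by (intro norm_triangle_le_diff add_mono C) (simp add: norm_mult mult_left_mono B)
    finally show ?thesis
      using K that by (simp add: D_def norm_mult field_simps)
  qed
  then have "eventually (\<lambda>y. norm (sh r y) \<le> D / y) at_top"
    by (auto intro: eventually_mono[OF eventually_gt_at_top[of 0]])
  moreover have "((\<lambda>y. D / y) \<longlongrightarrow> 0) at_top"
    by (rule tendsto_divide_0[OF tendsto_const filterlim_at_top_imp_at_infinity[OF filterlim_ident]])
  ultimately have sh: "(sh r \<longlongrightarrow> 0) at_top"
    by (rule Lim_null_comparison)
  have "((\<lambda>y. sh r (y + t)) \<longlongrightarrow> 0) at_top"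
    by (rule tendsto_at_top_shift[OF sh])
  \<comment> \<open>Solving the addition formula for \<open>ch r y\<close> expresses it by two
    decaying terms; this is where \<open>sh r t\<close> must not vanish.\<close>
  then have "((\<lambda>y. (sh r (y + t) - sh r y * ch r t) / sh r t)
      \<longlongrightarrow> (0 - 0 * ch r t) / sh r t) at_top"
    using t by (intro tendsto_intros sh) auto
  moreover have "(sh r (y + t) - sh r y * ch r t) / sh r t = ch r y" for y
    using t by (simp add: sh_add)
  ultimately show False
    using ch_not_tendsto_0 by simp
qed

section \<open>Bounded even solutions of linear equations of order two and four\<close>

text \<open>With the integrating factor \<open>exp (- r y)\<close> the product is constant, and it
  vanishes at \<open>0\<close>.\<close>

lemma linear_ode_unique_0:
  fixes f :: "real \<Rightarrow> complex"
  assumes "\<And>y. (f has_vector_derivative r * f y) (at y)" and "f 0 = 0"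
  shows "f y = 0"
proof -
  define e where "e y = exp (- r * of_real y)" for y :: real
  have e: "(e has_vector_derivative - r * e y) (at y)" for y
  proof -
    have "((\<lambda>z. exp (- r * z)) has_field_derivative - r * exp (- r * of_real y)) (at (of_real y))"
      by (auto intro!: derivative_eq_intros)
    from field_vector_diff_chain_at[OF has_vector_derivative_of_real[OF DERIV_ident] this]
    show ?thesis by (simp add: o_def e_def[abs_def])
  qed
  have "((\<lambda>y. f y * e y) has_vector_derivative 0) (at y)" for y
    by (rule has_vector_derivative_eq_rhs[OF has_vector_derivative_mult[OF assms(1) e]])
      (simp add: algebra_simps)
  then obtain c where "\<And>y. f y * e y = c"
    using has_vector_derivative_zero_constant[of UNIV "\<lambda>y. f y * e y"] by auto
  from this[of y] this[of 0] assms(2) show ?thesis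
    by (simp add: e_def)
qed

text \<open>The difference \<open>w\<close> from the candidate has zero initial data. Factoring the
  operator as \<open>(D - r) (D + r)\<close> leaves two first-order uniqueness problems.\<close>

lemma second_order_even_solution:
  assumes u: "\<And>y. (u has_vector_derivative u' y) (at y)"
    and u': "\<And>y. (u' has_vector_derivative r\<^sup>2 * u y) (at y)"
    and "u' 0 = 0"
  shows "u y = u 0 * ch r y"
proof -
  define w where "w y = u y - u 0 * ch r y" for y
  define w' where "w' y = u' y - u 0 * (r\<^sup>2 * sh r y)" for y
  have w: "(w has_vector_derivative w' y) (at y)" for y
    unfolding w_def[abs_def] w'_def by (auto intro!: derivative_eq_intros u)
  have w': "(w' has_vector_derivative r\<^sup>2 * w y) (at y)" for y
    unfolding w'_def[abs_def] w_def
    by (auto intro!: derivative_eq_intros u' simp: algebra_simps)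
  have "((\<lambda>y. w' y + r * w y) has_vector_derivative r * (w' y + r * w y)) (at y)" for y
    by (rule has_vector_derivative_eq_rhs
        [OF has_vector_derivative_add[OF w' has_vector_derivative_mult_right[OF w]]])
      (simp add: algebra_simps power2_eq_square)
  from linear_ode_unique_0[OF this] have "w' y + r * w y = 0" for y
    using assms(3) by (simp add: w_def w'_def)
  then have "w' y = - r * w y" for y
    by (simp add: eq_neg_iff_add_eq_0)
  with w have "(w has_vector_derivative - r * w y) (at y)" for y
    by metis
  from linear_ode_unique_0[OF this, of y] show ?thesis
    by (simp add: w_def)
qed

text \<open>The absolute value yields a non-negative frequency, as
  \<open>trigonometric_combination\<close> demands; cosine being even permits it.\<close>

lemma ch_imaginary: "Re r = 0 \<Longrightarrow> ch r y = of_real (cos (\<bar>Im r\<bar> * y))"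
proof -
  assume "Re r = 0"
  then have "\<i> * (r * of_real y) = of_real (- (Im r * y))"
    by (simp add: complex_eq_iff)
  then have "ch r y = cos (of_real (- (Im r * y)))"
    by (simp only: ch_def cosh_conv_cos)
  then show ?thesis
    by (simp only: cos_of_real cos_minus) (simp add: abs_if)
qed

text \<open>Taking real parts gives two cosines. The last two conclusions tie each visible frequency
  to the squared rate of its mode.\<close>

lemma real_two_modes:
  fixes h :: "real \<Rightarrow> real"
  assumes h: "\<And>y. of_real (h y) = A * ch r y + B * ch q y"
    and r: "A \<noteq> 0 \<Longrightarrow> Re r = 0" and q: "B \<noteq> 0 \<Longrightarrow> Re q = 0"
    and "A \<noteq> 0 \<Longrightarrow> B \<noteq> 0 \<Longrightarrow> r\<^sup>2 \<noteq> q\<^sup>2"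
  obtains \<alpha> \<beta> w z where "0 \<le> w" "0 \<le> z" "w \<noteq> z"
    and "\<And>y. h y = \<alpha> * cos (w * y) + \<beta> * cos (z * y)"
    and "\<alpha> \<noteq> 0 \<Longrightarrow> A \<noteq> 0 \<and> r\<^sup>2 = of_real (- w\<^sup>2)"
    and "\<beta> \<noteq> 0 \<Longrightarrow> B \<noteq> 0 \<and> q\<^sup>2 = of_real (- z\<^sup>2)"
proof -
  \<comment> \<open>An absent mode receives a dummy frequency, larger by one than the other, so that
    the two always differ.\<close>
  define w where "w = (if A = 0 then \<bar>Im q\<bar> + 1 else \<bar>Im r\<bar>)"
  define z where "z = (if A \<noteq> 0 \<and> B = 0 then \<bar>Im r\<bar> + 1 else \<bar>Im q\<bar>)"
  have sq: "p\<^sup>2 = of_real (- \<bar>Im p\<bar>\<^sup>2)" if "Re p = 0" for p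
    using that by (simp add: complex_eq_iff power2_eq_square)
  have "\<bar>Im r\<bar> \<noteq> \<bar>Im q\<bar>" if "A \<noteq> 0" "B \<noteq> 0"
    using assms(2-4) sq[of r] sq[of q] that by metis
  then have "w \<noteq> z"
    by (auto simp: w_def z_def)
  have "0 \<le> w" "0 \<le> z"
    by (simp_all add: w_def z_def)
  have A: "Re (A * ch r y) = Re A * cos (w * y)" for y
    by (cases "A = 0") (simp_all add: w_def ch_imaginary r)
  have B: "Re (B * ch q y) = Re B * cos (z * y)" for y
    by (cases "B = 0") (simp_all add: z_def ch_imaginary q)
  have "h y = Re A * cos (w * y) + Re B * cos (z * y)" for y
    using arg_cong[OF h[of y], of Re] by (simp only: Re_complex_of_real plus_complex.sel A B)
  moreover have "A \<noteq> 0 \<and> r\<^sup>2 = of_real (- w\<^sup>2)" if "Re A \<noteq> 0"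
  proof -
    have "A \<noteq> 0" using that by auto
    then show ?thesis using r sq[of r] by (simp add: w_def)
  qed
  moreover have "B \<noteq> 0 \<and> q\<^sup>2 = of_real (- z\<^sup>2)" if "Re B \<noteq> 0"
  proof -
    have "B \<noteq> 0" using that by auto
    then show ?thesis using q sq[of q] by (simp add: z_def)
  qed
  ultimately show ?thesis
    using \<open>w \<noteq> z\<close> \<open>0 \<le> w\<close> \<open>0 \<le> z\<close> by (intro that[of w z "Re A" "Re B"]) blast+
qed

lemma bounded_single_mode:
  assumes "\<And>y. f y = A * ch r y" and "bounded (range f)" and "A \<noteq> 0"
  shows "Re r = 0"
proof -
  have "f = (\<lambda>y. A * ch r y)"
    using assms(1) by auto
  with assms(2) have "bounded (range (\<lambda>y. A * ch r y))"
    by simp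
  from bounded_range_scale_cancel[OF this assms(3)] show ?thesis
    by (rule bounded_ch_imp_Re_0)
qed

lemma bounded_range_of_real:
  fixes h :: "'a \<Rightarrow> real"
  assumes "bounded (range h)"
  shows "bounded (range (\<lambda>y. complex_of_real (h y)))"
  using bounded_linear_image[OF assms bounded_linear_of_real[where 'a = complex]]
  by (simp add: image_image)

lemma bounded_even_second_order:
  fixes h h1 :: "real \<Rightarrow> real"
  assumes h: "\<And>y. (h has_real_derivative h1 y) (at y)"
    and h1: "\<And>y. (h1 has_real_derivative K * h y) (at y)"
    and "h1 0 = 0" and bdd: "bounded (range h)"
  obtains \<alpha> w where "0 \<le> w" "\<And>y. h y = \<alpha> * cos (w * y)" "\<alpha> \<noteq> 0 \<Longrightarrow> K = - w\<^sup>2"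
proof -
  \<comment> \<open>The complex root handles both signs of \<open>K\<close> together.\<close>
  define r where "r = csqrt (of_real K)"
  have r: "r\<^sup>2 = of_real K" by (simp add: r_def)
  have eq: "of_real (h y) = of_real (h 0) * ch r y" for y
  proof (rule second_order_even_solution)
    show "((\<lambda>y. of_real (h y)) has_vector_derivative of_real (h1 y)) (at y)" for y
      by (rule has_vector_derivative_of_real[OF h])
    show "((\<lambda>y. of_real (h1 y)) has_vector_derivative r\<^sup>2 * of_real (h y)) (at y)" for y
      using has_vector_derivative_of_real[OF h1, where 'a = complex] by (simp add: r)
    show "complex_of_real (h1 0) = 0"
      using assms(3) by simp
  qed
  have Re: "Re r = 0" if "complex_of_real (h 0) \<noteq> 0"
    using bounded_single_mode[OF eq bounded_range_of_real[OF bdd] that] .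
  show ?thesis
  proof (rule that[of "\<bar>Im r\<bar>" "h 0"])
    show "h y = h 0 * cos (\<bar>Im r\<bar> * y)" for y
    proof (cases "h 0 = 0")
      case True
      then show ?thesis using eq[of y] by simp
    next
      case False
      then have "of_real (h y) = complex_of_real (h 0 * cos (\<bar>Im r\<bar> * y))"
        using eq[of y] Re by (simp add: ch_imaginary)
      then show ?thesis by (rule of_real_eq_iff[THEN iffD1])
    qed
    show "K = - (\<bar>Im r\<bar>)\<^sup>2" if "h 0 \<noteq> 0"
      using Re r that by (auto simp: complex_eq_iff power2_eq_square)
  qed simp
qed

text \<open>The operator \<open>D\<^sup>4 + P D\<^sup>2 + Q\<close> factors as
  \<open>(D\<^sup>2 - r\<^sup>2) (D\<^sup>2 - q\<^sup>2)\<close>. Distinct factors give two modes; a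
  double factor gives one mode and a resonant term, which boundedness removes.\<close>

lemma bounded_even_fourth_order:
  fixes h h1 h2 h3 :: "real \<Rightarrow> real"
  assumes h: "\<And>y. (h has_real_derivative h1 y) (at y)"
    and h1: "\<And>y. (h1 has_real_derivative h2 y) (at y)"
    and h2: "\<And>y. (h2 has_real_derivative h3 y) (at y)"
    and h3: "\<And>y. (h3 has_real_derivative - P * h2 y - Q * h y) (at y)"
    and "h1 0 = 0" "h3 0 = 0" and bdd: "bounded (range h)"
  obtains \<alpha> \<beta> w z where "0 \<le> w" "0 \<le> z" "w \<noteq> z"
    and "\<And>y. h y = \<alpha> * cos (w * y) + \<beta> * cos (z * y)"
    and "\<alpha> \<noteq> 0 \<Longrightarrow> w ^ 4 - P * w\<^sup>2 + Q = 0"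
    and "\<beta> \<noteq> 0 \<Longrightarrow> z ^ 4 - P * z\<^sup>2 + Q = 0"
proof -
  \<comment> \<open>The squares of \<open>r\<close> and \<open>q\<close> are the roots of
    \<open>s\<^sup>2 + P s + Q\<close>, and \<open>d\<close> is a root of its discriminant.\<close>
  define d where "d = csqrt (of_real (P\<^sup>2 - 4 * Q))"
  define r where "r = csqrt ((- of_real P + d) / 2)"
  define q where "q = csqrt ((- of_real P - d) / 2)"
  have d: "d\<^sup>2 = of_real (P\<^sup>2 - 4 * Q)" by (simp add: d_def)
  have sum: "complex_of_real P = - (r\<^sup>2 + q\<^sup>2)"
    by (simp add: r_def q_def field_simps)
  have prod: "complex_of_real Q = r\<^sup>2 * q\<^sup>2"
  proof -
    have "r\<^sup>2 * q\<^sup>2 = ((of_real P)\<^sup>2 - d\<^sup>2) / 4"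
      unfolding r_def q_def power2_csqrt by (simp add: power2_eq_square field_simps)
    then show ?thesis by (simp add: d)
  qed
  define H H1 H2 H3 where "H y = complex_of_real (h y)" and "H1 y = complex_of_real (h1 y)"
    and "H2 y = complex_of_real (h2 y)" and "H3 y = complex_of_real (h3 y)" for y
  note H_defs = H_def[abs_def] H1_def[abs_def] H2_def[abs_def] H3_def[abs_def]
  have H: "(H has_vector_derivative H1 y) (at y)" and H1: "(H1 has_vector_derivative H2 y) (at y)"
    and H2: "(H2 has_vector_derivative H3 y) (at y)"
    and H3: "(H3 has_vector_derivative - P * H2 y - Q * H y) (at y)" for y
    using has_vector_derivative_of_real[OF h, where 'a = complex]
      has_vector_derivative_of_real[OF h1, where 'a = complex]
      has_vector_derivative_of_real[OF h2, where 'a = complex]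
      has_vector_derivative_of_real[OF h3, where 'a = complex]
    by (simp_all add: H_defs)
  have H_0: "H1 0 = 0" "H3 0 = 0"
    using assms(5,6) by (simp_all add: H_defs)
  have cbdd: "bounded (range H)"
    unfolding H_defs by (rule bounded_range_of_real[OF bdd])
  define u where "u p y = H2 y - p * H y" for p y
  \<comment> \<open>Applying one factor to \<open>H\<close> leaves a solution of the second-order
    equation of the other factor.\<close>
  have u: "u p y = u p 0 * ch s y" if "p = r\<^sup>2 \<and> s = q \<or> p = q\<^sup>2 \<and> s = r" for p s y
  proof (rule second_order_even_solution)
    show "(u p has_vector_derivative H3 y - p * H1 y) (at y)" for y
      unfolding u_def[abs_def] by (auto intro!: derivative_eq_intros H H2)
    show "((\<lambda>y. H3 y - p * H1 y) has_vector_derivative s\<^sup>2 * u p y) (at y)" for y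
      using that
      by (auto intro!: derivative_eq_intros H1 H3 simp: u_def sum prod algebra_simps)
    show "H3 0 - p * H1 0 = 0"
      using H_0 by simp
  qed
  have root: "x ^ 4 - P * x\<^sup>2 + Q = 0" if "of_real (- x\<^sup>2) = r\<^sup>2 \<or> of_real (- x\<^sup>2) = q\<^sup>2" for x
  proof -
    have "complex_of_real (x ^ 4 - P * x\<^sup>2 + Q)
        = (of_real (- x\<^sup>2) - r\<^sup>2) * (of_real (- x\<^sup>2) - q\<^sup>2)"
      by (simp add: sum prod algebra_simps power2_eq_square power4_eq_xxxx)
    then show ?thesis
      using that by (metis diff_self mult_eq_0_iff of_real_eq_0_iff)
  qed
  have "\<exists>A B. (\<forall>y. H y = A * ch r y + B * ch q y) \<and> (A \<noteq> 0 \<longrightarrow> Re r = 0)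
    \<and> (B \<noteq> 0 \<longrightarrow> Re q = 0) \<and> (A \<noteq> 0 \<longrightarrow> B \<noteq> 0 \<longrightarrow> r\<^sup>2 \<noteq> q\<^sup>2)"
  proof (cases "r\<^sup>2 = q\<^sup>2")
    case False
    \<comment> \<open>The values come from \<open>u (q\<^sup>2) y - u (r\<^sup>2) y = (r\<^sup>2 -
      q\<^sup>2) * H y\<close>.\<close>
    define A where "A = u (q\<^sup>2) 0 / (r\<^sup>2 - q\<^sup>2)"
    define B where "B = - u (r\<^sup>2) 0 / (r\<^sup>2 - q\<^sup>2)"
    have eq: "H y = A * ch r y + B * ch q y" for y
    proof -
      have "H y = (u (q\<^sup>2) y - u (r\<^sup>2) y) / (r\<^sup>2 - q\<^sup>2)"
        using False by (simp add: u_def field_simps)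
      also have "\<dots> = A * ch r y + B * ch q y"
        using u[of "q\<^sup>2" r y] u[of "r\<^sup>2" q y] by (simp add: A_def B_def diff_divide_distrib)
      finally show ?thesis .
    qed
    have eq': "H y = B * ch q y + A * ch r y" for y
      by (simp add: eq)
    show ?thesis
      using eq bounded_two_modes[OF False eq cbdd] bounded_two_modes[OF False[symmetric] eq' cbdd]
        False by blast
  next
    case True
    define k where "k = u (r\<^sup>2) 0"
    have k: "H2 y = r\<^sup>2 * H y + k * ch r y" for y
      using u[of "r\<^sup>2" r y] True by (simp add: k_def u_def algebra_simps)
    \<comment> \<open>Since \<open>(y sh)'' = r\<^sup>2 (y sh) + 2 ch\<close>, half of
      \<open>k\<close> times \<open>y sh\<close> is a particular solution; \<open>f\<close> solves
      the homogeneous equation.\<close>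
    define f where "f y = H y - k / 2 * (of_real y * sh r y)" for y
    define f' where "f' y = H1 y - k / 2 * (sh r y + of_real y * ch r y)" for y
    have y: "(complex_of_real has_vector_derivative 1) (at y)" for y
      using has_vector_derivative_of_real[OF DERIV_ident, where 'a = complex] by simp
    have "f y = f 0 * ch r y" for y
    proof (rule second_order_even_solution)
      show "(f has_vector_derivative f' y) (at y)" for y
        unfolding f_def[abs_def] f'_def
        by (auto intro!: derivative_eq_intros H y simp: algebra_simps)
      show "(f' has_vector_derivative r\<^sup>2 * f y) (at y)" for y
        unfolding f_def f'_def[abs_def]
        by (auto intro!: derivative_eq_intros H1 y simp: k algebra_simps)
      show "f' 0 = 0"
        using H_0 by (simp add: f'_def)
    qed
    then have eq: "H y = f 0 * ch r y + k / 2 * (of_real y * sh r y)" for y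
      by (metis diff_add_cancel f_def)
    have "k / 2 = 0"
      by (rule bounded_resonant_mode[OF eq cbdd])
    then have eq': "H y = f 0 * ch r y" for y
      using eq[of y] by simp
    show ?thesis
      using eq' bounded_single_mode[OF eq' cbdd]
      by (intro exI[of _ "f 0"] exI[of _ 0]) auto
  qed
  then obtain A B where *: "\<And>y. of_real (h y) = A * ch r y + B * ch q y"
    "A \<noteq> 0 \<Longrightarrow> Re r = 0" "B \<noteq> 0 \<Longrightarrow> Re q = 0" "A \<noteq> 0 \<Longrightarrow> B \<noteq> 0 \<Longrightarrow> r\<^sup>2 \<noteq> q\<^sup>2"
    unfolding H_defs by blast
  show ?thesis
  proof (rule real_two_modes[OF *])
    fix \<alpha> \<beta> w z :: real
    assume "0 \<le> w" "0 \<le> z" "w \<noteq> z" "\<And>y. h y = \<alpha> * cos (w * y) + \<beta> * cos (z * y)"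
      "\<alpha> \<noteq> 0 \<Longrightarrow> A \<noteq> 0 \<and> r\<^sup>2 = of_real (- w\<^sup>2)" "\<beta> \<noteq> 0 \<Longrightarrow> B \<noteq> 0 \<and> q\<^sup>2 = of_real (- z\<^sup>2)"
    then show thesis
      using root[of w] root[of z] by (intro that[of w z \<alpha> \<beta>]) auto
  qed blast+
qed

text \<open>The cosines are modes with rates \<open>\<i> * w\<close> and \<open>\<i> * z\<close>,
  whose squares differ because the frequencies are non-negative and distinct.\<close>

lemma two_cosines_tendsto_0:
  fixes w z :: real
  assumes "((\<lambda>y. \<alpha> * cos (w * y) + \<beta> * cos (z * y)) \<longlongrightarrow> 0) at_top"
    and "0 \<le> w" "0 \<le> z" "w \<noteq> z"
  shows "\<alpha> = 0"
proof -
  have "((\<lambda>y. complex_of_real (\<alpha> * cos (w * y) + \<beta> * cos (z * y))) \<longlongrightarrow> of_real 0) at_top"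
    by (rule tendsto_of_real[OF assms(1)])
  moreover have "complex_of_real (\<alpha> * cos (w * y) + \<beta> * cos (z * y))
      = of_real \<alpha> * ch (\<i> * of_real w) y + of_real \<beta> * ch (\<i> * of_real z) y" for y
    using assms(2,3) by (simp add: ch_imaginary)
  moreover have "(\<i> * of_real w)\<^sup>2 \<noteq> (\<i> * of_real z)\<^sup>2"
    using assms(2-4) by (simp add: power_mult_distrib flip: of_real_power)
  ultimately have "complex_of_real \<alpha> = 0"
    by (intro tendsto_0_two_modes[of "\<i> * of_real w" "\<i> * of_real z"
          "\<lambda>y. complex_of_real (\<alpha> * cos (w * y) + \<beta> * cos (z * y))" _ "of_real \<beta>"]) simp_all
  then show ?thesis by simp
qed

section \<open>Derivatives under reflection and translation\<close>

text \<open>The inner derivative \<open>-1\<close> flips the parity \<open>\<sigma>\<close>, which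
  is \<open>1\<close> or \<open>-1\<close> in all uses.\<close>

lemma deriv_reflection:
  fixes f :: "real \<Rightarrow> real"
  assumes "\<And>x. f (2 * p - x) = \<sigma> * f x" and "f differentiable (at y)" and "f differentiable (at (2 * p - y))"
  shows "deriv f (2 * p - y) = - \<sigma> * deriv f y"
proof -
  have "(f has_real_derivative deriv f (2 * p - y)) (at (2 * p - y))"
    using assms(3) by (simp add: DERIV_deriv_iff_real_differentiable)
  then have "((\<lambda>x. f (2 * p - x)) has_real_derivative deriv f (2 * p - y) * - 1) (at y)"
    by (rule DERIV_chain2) (auto intro!: derivative_eq_intros)
  then have "((\<lambda>x. \<sigma> * f x) has_real_derivative - deriv f (2 * p - y)) (at y)"
    by (simp add: assms(1))
  moreover have "((\<lambda>x. \<sigma> * f x) has_real_derivative \<sigma> * deriv f y) (at y)"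
    using assms(2) by (auto intro!: DERIV_cmult simp: DERIV_deriv_iff_real_differentiable)
  ultimately show ?thesis
    using DERIV_unique by fastforce
qed

lemma iterated_deriv_reflection:
  fixes f :: "real \<Rightarrow> real"
  assumes "\<And>x. f (2 * p - x) = f x"
    and "\<And>j x. j < k \<Longrightarrow> (deriv ^^ j) f differentiable (at x)"
  shows "j \<le> k \<Longrightarrow> (deriv ^^ j) f (2 * p - x) = (- 1) ^ j * (deriv ^^ j) f x"
proof (induction j arbitrary: x)
  case 0
  then show ?case using assms(1) by simp
next
  case (Suc j)
  then show ?case
    using deriv_reflection[of "(deriv ^^ j) f" p "(- 1) ^ j" x] assms(2)[of j] by simp
qed

text \<open>\<open>deriv\<close> selects a number by the derivative predicate, which is translation
  invariant; so the identity holds even where no derivative exists.\<close>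

lemma iterated_deriv_shift:
  fixes f :: "real \<Rightarrow> real"
  shows "(deriv ^^ j) (\<lambda>x. f (x + d)) = (\<lambda>x. (deriv ^^ j) f (x + d))"
proof (induction j)
  case (Suc j)
  have "deriv (\<lambda>x. F (x + d)) = (\<lambda>x. deriv F (x + d))" for F :: "real \<Rightarrow> real"
    by (simp add: fun_eq_iff deriv_def DERIV_shift)
  with Suc show ?case
    by simp
qed simp

section \<open>The linear profile equation with possibly vanishing coefficients\<close>

text \<open>The highest non-zero coefficient decides the order. Differentiability is tied to
  non-zero coefficients, matching what \<open>appearing_regularity\<close> provides.\<close>

lemma bounded_even_linear_ode:
  fixes h :: "real \<Rightarrow> real"
  assumes even: "\<And>y. h (- y) = h y"
    and ode: "\<And>y. b0 * h y + b2 * (deriv ^^ 2) h y + b4 * (deriv ^^ 4) h y = 0"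
    and diff2: "\<And>j y. b2 \<noteq> 0 \<Longrightarrow> j < 2 \<Longrightarrow> (deriv ^^ j) h differentiable (at y)"
    and diff4: "\<And>j y. b4 \<noteq> 0 \<Longrightarrow> j < 4 \<Longrightarrow> (deriv ^^ j) h differentiable (at y)"
    and nz: "b0 \<noteq> 0 \<or> b2 \<noteq> 0 \<or> b4 \<noteq> 0" and bdd: "bounded (range h)"
  obtains \<alpha> \<beta> w z where "0 \<le> w" "0 \<le> z" "w \<noteq> z"
    and "\<And>y. h y = \<alpha> * cos (w * y) + \<beta> * cos (z * y)"
    and "\<alpha> \<noteq> 0 \<Longrightarrow> b4 * w ^ 4 - b2 * w\<^sup>2 + b0 = 0"
    and "\<beta> \<noteq> 0 \<Longrightarrow> b4 * z ^ 4 - b2 * z\<^sup>2 + b0 = 0"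
proof -
  have D: "((deriv ^^ j) h has_real_derivative (deriv ^^ Suc j) h y) (at y)"
    if "(deriv ^^ j) h differentiable (at y)" for j y
    using that by (simp add: DERIV_deriv_iff_real_differentiable)
  \<comment> \<open>At the axis the reflection makes a derivative of odd order equal to its own
    negative.\<close>
  have odd: "(deriv ^^ j) h 0 = 0"
    if "\<And>i y. i < k \<Longrightarrow> (deriv ^^ i) h differentiable (at y)" "odd j" "j \<le> k" for j k
    using iterated_deriv_reflection[of h 0 k j 0] that even by simp
  consider "b4 \<noteq> 0" | "b4 = 0" "b2 \<noteq> 0" | "b4 = 0" "b2 = 0" by blast
  then show ?thesis
  proof cases
    case 1
    note d = D[OF diff4[OF 1]]
    have h3: "((deriv ^^ 3) h has_real_derivative
        - (b2 / b4) * (deriv ^^ 2) h y - (b0 / b4) * h y) (at y)" for y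
    proof -
      have "(deriv ^^ 4) h y = - (b2 / b4) * (deriv ^^ 2) h y - (b0 / b4) * h y"
        using ode[of y] 1 by (simp add: field_simps)
      then show ?thesis using d[of 3 y] by (simp add: eval_nat_numeral)
    qed
    show ?thesis
    proof (rule bounded_even_fourth_order[of h "(deriv ^^ 1) h" "(deriv ^^ 2) h" "(deriv ^^ 3) h"])
      show "(h has_real_derivative (deriv ^^ 1) h y) (at y)" for y
        using d[of 0 y] by simp
      show "((deriv ^^ 1) h has_real_derivative (deriv ^^ 2) h y) (at y)" for y
        using d[of 1 y] by (simp add: eval_nat_numeral)
      show "((deriv ^^ 2) h has_real_derivative (deriv ^^ 3) h y) (at y)" for y
        using d[of 2 y] by (simp add: eval_nat_numeral)
      show "(deriv ^^ 1) h 0 = 0" "(deriv ^^ 3) h 0 = 0"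
        using odd[OF diff4[OF 1], of 4 1] odd[OF diff4[OF 1], of 4 3] by simp_all
    next
      fix \<alpha> \<beta> w z
      assume *: "0 \<le> w" "0 \<le> z" "w \<noteq> z" "\<And>y. h y = \<alpha> * cos (w * y) + \<beta> * cos (z * y)"
        "\<alpha> \<noteq> 0 \<Longrightarrow> w ^ 4 - b2 / b4 * w\<^sup>2 + b0 / b4 = 0"
        "\<beta> \<noteq> 0 \<Longrightarrow> z ^ 4 - b2 / b4 * z\<^sup>2 + b0 / b4 = 0"
      have "b4 * x ^ 4 - b2 * x\<^sup>2 + b0 = 0" if "x ^ 4 - b2 / b4 * x\<^sup>2 + b0 / b4 = 0" for x
        using that 1 by (simp add: field_simps)
      with * show thesis by (intro that[of w z \<alpha> \<beta>]) blast+
    qed (fact h3 bdd)+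
  next
    case 2
    note d = D[OF diff2[OF 2(2)]]
    have h1: "((deriv ^^ 1) h has_real_derivative - (b0 / b2) * h y) (at y)" for y
    proof -
      have "(deriv ^^ 2) h y = - (b0 / b2) * h y"
        using ode[of y] 2 by (simp add: field_simps)
      then show ?thesis using d[of 1 y] by (simp add: eval_nat_numeral)
    qed
    have h0: "(h has_real_derivative (deriv ^^ 1) h y) (at y)" for y
      using d[of 0 y] by simp
    have "(deriv ^^ 1) h 0 = 0"
      using odd[OF diff2[OF 2(2)], of 2 1] by simp
    from bounded_even_second_order[OF h0 h1 this bdd]
    obtain \<alpha> w where *: "0 \<le> w" "\<And>y. h y = \<alpha> * cos (w * y)" "\<alpha> \<noteq> 0 \<Longrightarrow> - (b0 / b2) = - w\<^sup>2"
      by blast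
    \<comment> \<open>The frequency \<open>w + 1\<close> is a dummy with amplitude
      \<open>0\<close>.\<close>
    then show ?thesis
      using 2 by (intro that[of w "w + 1" \<alpha> 0]) (auto simp: field_simps)
  next
    case 3
    with ode nz have "h y = 0" for y by simp
    then show ?thesis
      by (intro that[of 0 1 0 0]) auto
  qed
qed

section \<open>Reduction of the evolution equation to the profile equation\<close>

lemma dx_eq_deriv: "dx k u t = (deriv ^^ k) (u t)"
  by (simp add: fun_eq_iff dx_def)

lemma dx_travels_with:
  assumes "travels_with I u g c" and "t \<in> I"
  shows "dx k u t x = (deriv ^^ k) g (x - c * t)"
proof -
  have "u t = (\<lambda>x. g (x + - (c * t)))"
    using assms by (auto simp: travels_with_def)
  then show ?thesis
    by (simp only: dx_def iterated_deriv_shift) simp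
qed

text \<open>At the interior time \<open>T / 2\<close> the time derivative is two-sided, and reflecting the profile
  amounts to reversing time.\<close>

lemma dt_reflection:
  assumes "T > 0" and u: "\<And>t x. t \<in> {0..T} \<Longrightarrow> u t x = F (x - c * t)"
    and "has_dt {0..T} u"
    and even: "\<And>x. u (T / 2) (2 * \<mu> - x) = u (T / 2) x"
  shows "dt {0..T} u (T / 2) (2 * \<mu> - x) = - dt {0..T} u (T / 2) x"
proof -
  have at: "at (T / 2) within {0..T} = at (T / 2)"
    using assms(1) by (intro at_within_interior) (simp add: interior_atLeastAtMost_real)
  have half: "T / 2 \<in> {0..T}" using assms(1) by auto
  \<comment> \<open>The symmetry of \<open>u\<close> at time \<open>T / 2\<close> says that
    \<open>F\<close> is symmetric about \<open>\<mu> - c * T / 2\<close>.\<close>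
  have F: "F y = F (2 * \<mu> - c * T - y)" for y
  proof -
    have "F (2 * \<mu> - (y + c * (T / 2)) - c * (T / 2)) = F (y + c * (T / 2) - c * (T / 2))"
      using even[of "y + c * (T / 2)"] unfolding u[OF half] .
    moreover have "2 * \<mu> - (y + c * (T / 2)) - c * (T / 2) = 2 * \<mu> - c * T - y"
      by (simp add: field_simps)
    ultimately show ?thesis by (metis add_diff_cancel_right')
  qed
  have rev: "u s (2 * \<mu> - x) = u (T - s) x" if "s \<in> {0..T}" for s
  proof -
    have "u s (2 * \<mu> - x) = F (2 * \<mu> - c * T - (2 * \<mu> - x - c * s))"
      using u[OF that] F by metis
    also have "2 * \<mu> - c * T - (2 * \<mu> - x - c * s) = x - c * (T - s)"
      by (simp add: algebra_simps)
    also have "F \<dots> = u (T - s) x"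
      using that by (subst u) auto
    finally show ?thesis .
  qed
  define D where "D = dt {0..T} u (T / 2) x"
  have "((\<lambda>s. u s x) has_vector_derivative D) (at (T / 2))"
    using assms(3) half at unfolding D_def has_dt_def dt_def
    by (metis vector_derivative_works)
  \<comment> \<open>Time reversal fixes \<open>T / 2\<close>; writing this point as
    \<open>T - T / 2\<close> prepares the chain rule.\<close>
  then have "((\<lambda>s. u s x) has_real_derivative D) (at (T - T / 2))"
    by (simp add: has_real_derivative_iff_has_vector_derivative)
  then have "((\<lambda>s. u (T - s) x) has_real_derivative D * - 1) (at (T / 2))"
    by (rule DERIV_chain2) (auto intro!: derivative_eq_intros)
  then have "((\<lambda>s. u (T - s) x) has_vector_derivative - D) (at (T / 2))"
    by (simp add: has_real_derivative_iff_has_vector_derivative)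
  then have "((\<lambda>s. u s (2 * \<mu> - x)) has_vector_derivative - D) (at (T / 2))"
    by (rule has_vector_derivative_transform_within_open[of _ _ _ "{0<..<T}"])
      (use assms(1) rev in auto)
  then show ?thesis
    by (simp add: dt_def at D_def vector_derivative_at)
qed

text \<open>The equation is compared at \<open>x\<close> and at its mirror image \<open>x'\<close>.
  A term is odd when it contains an odd number of derivatives, counting the one in time.\<close>

lemma symmetric_traveling_solution_ode:
  assumes "classical_solution {0..T} m n a b v" and "T > 0"
    and "travels_with {0..T} v g c"
    and sym: "\<And>x. v (T / 2) (2 * \<mu> - x) = v (T / 2) x"
  shows "b 1 * v (T / 2) x + b 2 * dx 2 v (T / 2) x + b 10 * dx 4 v (T / 2) x = 0"
proof -
  define x' where "x' = 2 * \<mu> - x"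
  define t where "t = T / 2"
  have t: "t \<in> {0..T}" using assms(2) by (simp add: t_def)
  have reg: "appearing_regularity {0..T} a b v" and eq: "satisfies_rkdv_rlw {0..T} m n a b v"
    using assms(1) by (auto simp: classical_solution_def)
  have sym': "v t (2 * \<mu> - x) = v t x" for x
    using sym by (simp add: t_def)
  have reflect: "dx j v t (2 * \<mu> - x) = (- 1) ^ j * dx j v t x" if "has_dx {0..T} k v" "j \<le> k" for j k x
    unfolding dx_eq_deriv
  proof (rule iterated_deriv_reflection)
    show "v t (2 * \<mu> - y) = v t y" for y
      by (rule sym')
    show "(deriv ^^ i) (v t) differentiable (at y)" if "i < k" for i y
      using \<open>has_dx {0..T} k v\<close> t that by (simp add: has_dx_def flip: dx_eq_deriv)
  qed (fact that)
  have Dx: "dx j v t x' = (- 1) ^ j * dx j v t x" if "has_continuous_dx {0..T} k v" "j \<le> k" for j k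
    using that reflect by (auto simp: has_continuous_dx_def x'_def)
  \<comment> \<open>The derivatives \<open>dx k v\<close> travel with the same speed, and for even
    \<open>k\<close> they keep the symmetry, so time reversal applies to them too.\<close>
  have Dt: "dt {0..T} (dx k v) t x' = - dt {0..T} (dx k v) t x"
    if "has_continuous_dxt {0..T} k v" "even k" for k
    unfolding t_def x'_def
    by (rule dt_reflection[where F = "(deriv ^^ k) g"])
      (use assms(2) that reflect[of k k] dx_travels_with[OF assms(3)] in
        \<open>auto simp: has_continuous_dxt_def t_def\<close>)
  have V: "v t x' = v t x" using sym by (simp add: t_def x'_def)
  have dx_0: "dx 0 v = v" by (simp add: dx_def fun_eq_iff)
  have L0: "dt {0..T} v t x' = - dt {0..T} v t x"
    using Dt[of 0] reg by (simp add: appearing_regularity_def dx_0)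
  \<comment> \<open>Regularity is available only when the coefficient is non-zero; hence the case
    split here and in most terms below.\<close>
  have L1: "a 1 * dx 1 v t x' = - (a 1 * dx 1 v t x)"
    using Dx[of 1 1] reg by (cases "a 1 = 0") (auto simp: appearing_regularity_def)
  have L2: "a 2 * dx 3 v t x' = - (a 2 * dx 3 v t x)"
    using Dx[of 3 3] reg by (cases "a 2 = 0") (auto simp: appearing_regularity_def)
  have L3: "a 3 * dt {0..T} (dx 2 v) t x' = - (a 3 * dt {0..T} (dx 2 v) t x)"
    using Dt[of 2] reg by (cases "a 3 = 0") (auto simp: appearing_regularity_def)
  have L4: "a 4 * dt {0..T} (dx 4 v) t x' = - (a 4 * dt {0..T} (dx 4 v) t x)"
    using Dt[of 4] reg by (cases "a 4 = 0") (auto simp: appearing_regularity_def)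
  have L5: "a 5 * dx 1 (\<lambda>s y. v s y ^ n) t x' = - (a 5 * dx 1 (\<lambda>s y. v s y ^ n) t x)"
  proof (cases "a 5 = 0")
    case False
    with reg have "has_continuous_dx {0..T} 1 v"
      by (auto simp: appearing_regularity_def)
    then have "v t differentiable (at y)" for y
      using t by (auto simp: has_continuous_dx_def has_dx_def dx_eq_deriv)
    then have "deriv (\<lambda>y. v t y ^ n) (2 * \<mu> - x) = - 1 * deriv (\<lambda>y. v t y ^ n) x"
      by (intro deriv_reflection) (simp_all add: sym')
    then show ?thesis by (simp add: dx_def x'_def)
  qed simp
  have R3: "b 3 * dx 1 v t x' * dx 2 v t x' = - (b 3 * dx 1 v t x * dx 2 v t x)"
    using Dx[of 2 1] Dx[of 2 2] reg by (cases "b 3 = 0") (auto simp: appearing_regularity_def)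
  have R4: "b 4 * v t x' ^ m * dx 1 v t x' = - (b 4 * v t x ^ m * dx 1 v t x)"
    using Dx[of 1 1] reg V by (cases "b 4 = 0") (auto simp: appearing_regularity_def)
  have R5: "b 5 * v t x' * dx 3 v t x' = - (b 5 * v t x * dx 3 v t x)"
    using Dx[of 3 3] reg V by (cases "b 5 = 0") (auto simp: appearing_regularity_def)
  have R6: "b 6 * v t x' * dx 1 v t x' * dx 2 v t x' = - (b 6 * v t x * dx 1 v t x * dx 2 v t x)"
    using Dx[of 2 1] Dx[of 2 2] reg V by (cases "b 6 = 0") (auto simp: appearing_regularity_def)
  have R7: "b 7 * dx 1 v t x' ^ 3 = - (b 7 * dx 1 v t x ^ 3)"
    using Dx[of 1 1] reg by (cases "b 7 = 0") (auto simp: appearing_regularity_def)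
  have R8: "b 8 * dx 1 v t x' * dx 4 v t x' = - (b 8 * dx 1 v t x * dx 4 v t x)"
    using Dx[of 4 1] Dx[of 4 4] reg by (cases "b 8 = 0") (auto simp: appearing_regularity_def)
  have R9: "b 9 * dx 2 v t x' * dx 3 v t x' = - (b 9 * dx 2 v t x * dx 3 v t x)"
    using Dx[of 3 2] Dx[of 3 3] reg by (cases "b 9 = 0") (auto simp: appearing_regularity_def)
  have R11: "b 11 * dx 5 v t x' = - (b 11 * dx 5 v t x)"
    using Dx[of 5 5] reg by (cases "b 11 = 0") (auto simp: appearing_regularity_def)
  have R12: "b 12 * v t x' * dx 5 v t x' = - (b 12 * v t x * dx 5 v t x)"
    using Dx[of 5 5] reg V by (cases "b 12 = 0") (auto simp: appearing_regularity_def)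
  have R2: "b 2 * dx 2 v t x' = b 2 * dx 2 v t x"
    using Dx[of 2 2] reg by (cases "b 2 = 0") (auto simp: appearing_regularity_def)
  have R10: "b 10 * dx 4 v t x' = b 10 * dx 4 v t x"
    using Dx[of 4 4] reg by (cases "b 10 = 0") (auto simp: appearing_regularity_def)
  have E: "dt {0..T} v t y + a 1 * dx 1 v t y + a 2 * dx 3 v t y
      + a 3 * dt {0..T} (dx 2 v) t y + a 4 * dt {0..T} (dx 4 v) t y
      + a 5 * dx 1 (\<lambda>s y. v s y ^ n) t y = perturbation m b v t y" for y
    using eq t by (simp add: satisfies_rkdv_rlw_def)
  \<comment> \<open>Adding the two instances cancels the odd terms and doubles the three even
    ones.\<close>
  show ?thesis
    using E[of x] E[of x'] V
    unfolding perturbation_def L0 L1 L2 L3 L4 L5 R2 R3 R4 R5 R6 R7 R8 R9 R10 R11 R12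
      t_def[symmetric]
    by (simp only:)
qed

text \<open>The slice at time \<open>T / 2\<close>, recentred at its axis, is an even solution of
  the linear equation. Continuity stands apart because decaying profiles need it to obtain
  boundedness.\<close>

lemma symmetric_traveling_profile:
  assumes sol: "classical_solution {0..T} m n a b v" and "T > 0"
    and "spatially_symmetric {0..T} v" and trav: "travels_with {0..T} v g c"
    and nz: "b 1 \<noteq> 0 \<or> b 2 \<noteq> 0 \<or> b 10 \<noteq> 0"
  shows "continuous_on UNIV g"
    and "bounded (range g) \<Longrightarrow> \<exists>p \<alpha> \<beta> w z. 0 \<le> w \<and> 0 \<le> z \<and> w \<noteq> z
      \<and> (\<forall>y. g y = \<alpha> * cos (w * (y - p)) + \<beta> * cos (z * (y - p)))
      \<and> (\<alpha> \<noteq> 0 \<longrightarrow> b 10 * w ^ 4 - b 2 * w\<^sup>2 + b 1 = 0)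
      \<and> (\<beta> \<noteq> 0 \<longrightarrow> b 10 * z ^ 4 - b 2 * z\<^sup>2 + b 1 = 0)"
proof -
  define t where "t = T / 2"
  have t: "t \<in> {0..T}" using assms(2) by (simp add: t_def)
  obtain \<mu> where sym: "\<And>x. v t (2 * \<mu> - x) = v t x"
    using assms(3) t by (metis spatially_symmetric_def)
  have ode: "b 1 * v t x + b 2 * dx 2 v t x + b 10 * dx 4 v t x = 0" for x
    using symmetric_traveling_solution_ode[OF sol assms(2) trav] sym unfolding t_def by blast
  have "has_dx {0..T} 2 v" if "b 2 \<noteq> 0"
    using sol that
    by (auto simp: classical_solution_def appearing_regularity_def has_continuous_dx_def)
  then have diff2: "dx j v t differentiable (at x)" if "b 2 \<noteq> 0" "j < 2" for j x
    using that t by (auto simp: has_dx_def)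
  have "has_dx {0..T} 4 v" if "b 10 \<noteq> 0"
    using sol that
    by (auto simp: classical_solution_def appearing_regularity_def has_continuous_dx_def)
  then have diff4: "dx j v t differentiable (at x)" if "b 10 \<noteq> 0" "j < 4" for j x
    using that t by (auto simp: has_dx_def)
  have g: "g y = v t (y + c * t)" for y
    using trav t by (simp add: travels_with_def)
  have "continuous_on UNIV (v t)"
  \<comment> \<open>If only \<open>b 1\<close> survives, the linear equation forces the slice to
    vanish; otherwise the slice is differentiable.\<close>
  proof (cases "b 2 = 0 \<and> b 10 = 0")
    case True
    with ode nz have "v t = (\<lambda>_. 0)" by auto
    then show ?thesis by simp
  next
    case False
    then have "v t differentiable (at x)" for x
      using diff2[of 0 x] diff4[of 0 x] by (auto simp: dx_eq_deriv)
    then show ?thesis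
      by (simp add: continuous_at_imp_continuous_on differentiable_imp_continuous_within)
  qed
  then show "continuous_on UNIV g"
    unfolding g[abs_def] by (rule continuous_on_compose2) (auto intro!: continuous_intros)
  define h where "h y = v t (y + \<mu>)" for y
  have h: "(deriv ^^ j) h = (\<lambda>y. dx j v t (y + \<mu>))" for j
    unfolding h_def[abs_def] iterated_deriv_shift by (simp add: dx_def)
  have shift_diff: "(\<lambda>y. f (y + \<mu>)) differentiable (at y)"
    if "\<And>x. f differentiable (at x)" for f :: "real \<Rightarrow> real" and y
    using that DERIV_shift by (metis real_differentiable_def)
  \<comment> \<open>The profile has its axis at \<open>\<mu> - c * t\<close>, which becomes the
    phase \<open>p\<close>.\<close>
  have gh: "g y = h (y - (\<mu> - c * t))" for y
    by (simp add: g h_def algebra_simps)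
  assume "bounded (range g)"
  moreover have "h y = g (y + (\<mu> - c * t))" for y
    by (simp add: gh)
  then have "range h \<subseteq> range g"
    by auto
  ultimately have bdd: "bounded (range h)"
    by (rule bounded_subset)
  have even: "h (- y) = h y" for y
    using sym[of "y + \<mu>"] by (simp add: h_def algebra_simps)
  have h_ode: "b 1 * h y + b 2 * (deriv ^^ 2) h y + b 10 * (deriv ^^ 4) h y = 0" for y
    unfolding h using ode by (simp add: h_def)
  have h_diff2: "(deriv ^^ j) h differentiable (at y)" if "b 2 \<noteq> 0" "j < 2" for j y
    unfolding h by (rule shift_diff[OF diff2[OF that]])
  have h_diff4: "(deriv ^^ j) h differentiable (at y)" if "b 10 \<noteq> 0" "j < 4" for j y
    unfolding h by (rule shift_diff[OF diff4[OF that]])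
  show "\<exists>p \<alpha> \<beta> w z. 0 \<le> w \<and> 0 \<le> z \<and> w \<noteq> z
      \<and> (\<forall>y. g y = \<alpha> * cos (w * (y - p)) + \<beta> * cos (z * (y - p)))
      \<and> (\<alpha> \<noteq> 0 \<longrightarrow> b 10 * w ^ 4 - b 2 * w\<^sup>2 + b 1 = 0)
      \<and> (\<beta> \<noteq> 0 \<longrightarrow> b 10 * z ^ 4 - b 2 * z\<^sup>2 + b 1 = 0)"
  proof (rule bounded_even_linear_ode[of h "b 1" "b 2" "b 10"])
    fix \<alpha> \<beta> w z
    assume "0 \<le> w" "0 \<le> z" "w \<noteq> z" "\<And>y. h y = \<alpha> * cos (w * y) + \<beta> * cos (z * y)"
      "\<alpha> \<noteq> 0 \<Longrightarrow> b 10 * w ^ 4 - b 2 * w\<^sup>2 + b 1 = 0"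
      "\<beta> \<noteq> 0 \<Longrightarrow> b 10 * z ^ 4 - b 2 * z\<^sup>2 + b 1 = 0"
    then show "\<exists>p \<alpha> \<beta> w z. 0 \<le> w \<and> 0 \<le> z \<and> w \<noteq> z
        \<and> (\<forall>y. g y = \<alpha> * cos (w * (y - p)) + \<beta> * cos (z * (y - p)))
        \<and> (\<alpha> \<noteq> 0 \<longrightarrow> b 10 * w ^ 4 - b 2 * w\<^sup>2 + b 1 = 0)
        \<and> (\<beta> \<noteq> 0 \<longrightarrow> b 10 * z ^ 4 - b 2 * z\<^sup>2 + b 1 = 0)"
      by (intro exI[of _ "\<mu> - c * t"] exI[of _ \<alpha>] exI[of _ \<beta>] exI[of _ w] exI[of _ z])
        (simp add: gh)
  qed (fact even h_ode h_diff2 h_diff4 nz bdd)+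
qed

section \<open>Properties of the profile\<close>

text \<open>The subtraction formula for cosine absorbs the phase \<open>p\<close>. Distinct
  frequencies let the amplitudes be read off from \<open>\<omega>\<close> and keep both terms of the
  sum over \<open>{w, z}\<close>.\<close>

lemma trigonometric_combination_two_cosines:
  assumes "0 \<le> w" "0 \<le> z" "w \<noteq> z"
    and "\<And>y. g y = \<alpha> * cos (w * (y - p)) + \<beta> * cos (z * (y - p))"
  shows "trigonometric_combination g"
  unfolding trigonometric_combination_def
proof (intro exI[of _ "{w, z}"] exI conjI)
  show "\<forall>y. g y = (\<Sum>\<omega>\<in>{w, z}. (if \<omega> = w then \<alpha> else \<beta>) * cos (\<omega> * p) * cos (\<omega> * y)
      + (if \<omega> = w then \<alpha> else \<beta>) * sin (\<omega> * p) * sin (\<omega> * y))"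
    using assms(3) by (auto simp: assms(4) cos_diff right_diff_distrib algebra_simps)
qed (use assms in auto)

text \<open>Outside a large ball the values lie within \<open>1\<close> of the limit; on the ball
  compactness applies.\<close>

lemma bounded_range_of_tendsto_at_infinity:
  fixes g :: "'a::euclidean_space \<Rightarrow> 'b::real_normed_vector"
  assumes "continuous_on UNIV g" and "(g \<longlongrightarrow> l) at_infinity"
  shows "bounded (range g)"
proof -
  obtain R where R: "\<And>x. R \<le> norm x \<Longrightarrow> dist (g x) l < 1"
    using tendstoD[OF assms(2), of 1] by (auto simp: eventually_at_infinity)
  have "range g \<subseteq> g ` cball 0 R \<union> ball l 1"
    using R by (force simp: dist_commute)
  moreover have "bounded (g ` cball 0 R)"
    by (intro compact_imp_bounded compact_continuous_image compact_cball)
      (rule continuous_on_subset[OF assms(1)], simp)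
  ultimately show ?thesis
    by (meson bounded_Un bounded_ball bounded_subset)
qed

lemma nontrivial_imp_profile_not_constant:
  assumes "nontrivial I v" and "travels_with I v g c"
  shows "\<not> (\<forall>y. g y = k)"
proof
  assume "\<forall>y. g y = k"
  with assms show False
    by (auto simp: nontrivial_def travels_with_def constant_on_def)
qed

lemma bounded_profile:
  assumes "bounded_function I v" and "travels_with I v g c" and "t \<in> I"
  shows "bounded (range g)"
proof -
  have "range g \<subseteq> (\<lambda>(t, x). v t x) ` (I \<times> UNIV)"
  proof
    fix z
    assume "z \<in> range g"
    then obtain y where "z = g y" by blast
    with assms(2,3) show "z \<in> (\<lambda>(t, x). v t x) ` (I \<times> UNIV)"
      by (intro image_eqI[of _ _ "(t, y + c * t)"]) (auto simp: travels_with_def)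
  qed
  with assms(1) show ?thesis
    unfolding bounded_function_def by (rule bounded_subset)
qed

section \<open>Negative roots of the characteristic quadratic\<close>

text \<open>The root \<open>s\<close> stands for \<open>- x\<^sup>2\<close> with \<open>x\<close> a
  non-zero frequency. For \<open>b4 \<noteq> 0\<close> the sign of the slope of the quadratic at
  \<open>s\<close> tells which root \<open>s\<close> is.\<close>

lemma coefficient_conditions:
  fixes b0 b2 b4 s :: real
  assumes "b4 * s\<^sup>2 + b2 * s + b0 = 0" and "s < 0" and nz: "b0 \<noteq> 0 \<or> b2 \<noteq> 0 \<or> b4 \<noteq> 0"
  shows "(b0 = 0 \<and> b2 * b4 > 0)
        \<or> (b2\<^sup>2 > 4 * b0 * b4 \<and> b0 < 0 \<and> b4 > 0)
        \<or> (b2\<^sup>2 > 4 * b0 * b4 \<and> (sqrt (b2\<^sup>2 - 4 * b0 * b4) - b2) * b4 < 0)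
        \<or> (b2\<^sup>2 = 4 * b0 * b4 \<and> b2 * b4 > 0)
        \<or> (b4 = 0 \<and> b2 \<noteq> 0 \<and> b0 * b2 > 0)"
proof (cases "b4 = 0")
  case True
  then have b0: "b0 = - s * b2" using assms(1) by (simp add: algebra_simps)
  with nz True have "b2 \<noteq> 0" by auto
  moreover from this have "s * b2\<^sup>2 < 0"
    using \<open>s < 0\<close> by (simp add: mult_neg_pos)
  then have "b0 * b2 > 0"
    by (simp add: b0 power2_eq_square)
  ultimately show ?thesis using True by simp
next
  case False
  \<comment> \<open>This is the slope at \<open>s\<close>; its square is the discriminant.\<close>
  define d where "d = 2 * b4 * s + b2"
  have "b0 = - (b4 * s\<^sup>2 + b2 * s)" using assms(1) by simp
  then have disc: "b2\<^sup>2 - 4 * b0 * b4 = d\<^sup>2"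
    by (simp only: d_def) (simp add: power2_eq_square algebra_simps)
  have neg: "b4\<^sup>2 * s < 0"
    using False \<open>s < 0\<close> by (simp add: mult_pos_neg)
  consider "d = 0" | "d > 0" | "d < 0" by linarith
  then show ?thesis
  proof cases
    case 1
    then have "b2 = - 2 * b4 * s"
      by (simp add: d_def)
    then have "b2 * b4 = - 2 * (b4\<^sup>2 * s)"
      by (simp add: power2_eq_square)
    then have "b2 * b4 > 0" using neg by linarith
    with 1 disc show ?thesis by simp
  next
    case 2
    \<comment> \<open>For \<open>d > 0\<close> the root with the positive sign of the square root is
      \<open>s\<close> itself, so condition (iii) holds.\<close>
    then have "sqrt (b2\<^sup>2 - 4 * b0 * b4) - b2 = 2 * b4 * s"
      by (simp add: disc) (simp add: d_def)
    then have "(sqrt (b2\<^sup>2 - 4 * b0 * b4) - b2) * b4 = 2 * (b4\<^sup>2 * s)"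
      by (simp add: power2_eq_square)
    with neg have "(sqrt (b2\<^sup>2 - 4 * b0 * b4) - b2) * b4 < 0" by linarith
    moreover have "b2\<^sup>2 > 4 * b0 * b4"
      using 2 disc by (metis diff_gt_0_iff_gt zero_less_power)
    ultimately show ?thesis by blast
  next
    case 3
    have gt: "b2\<^sup>2 > 4 * b0 * b4"
      using 3 disc by (metis diff_gt_0_iff_gt less_irrefl zero_less_power2)
    \<comment> \<open>The other root, by Vieta. For \<open>d < 0\<close> it is \<open>s'\<close>
      that carries the positive square root.\<close>
    define s' where "s' = - b2 / b4 - s"
    have b2: "b2 = - b4 * (s + s')" using False by (simp add: s'_def field_simps)
    have b0: "b0 = b4 * (s * s')"
      using assms(1) by (simp add: b2 power2_eq_square algebra_simps)
    have d: "d = b4 * (s - s')" by (simp add: d_def b2 algebra_simps)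
    have sqrt: "sqrt (b2\<^sup>2 - 4 * b0 * b4) - b2 = 2 * b4 * s'"
      using 3 by (simp add: disc) (simp add: d b2 algebra_simps)
    \<comment> \<open>The three signs of \<open>s'\<close> lead to conditions (iii), (i) and (ii),
      in this order.\<close>
    consider "s' < 0" | "s' = 0" | "s' > 0" by linarith
    then show ?thesis
    proof cases
      case 1
      then have "s' * b4\<^sup>2 < 0"
        using False by (simp add: mult_neg_pos)
      then have "(2 * b4 * s') * b4 < 0"
        by (simp add: power2_eq_square ac_simps)
      with gt show ?thesis unfolding sqrt by blast
    next
      case 2
      then have "b2 * b4 = - (b4\<^sup>2 * s)" "b0 = 0"
        by (simp_all add: b2 b0 power2_eq_square)
      moreover from this(1) have "b2 * b4 > 0" using neg by linarith
      ultimately show ?thesis by blast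
    next
      case s': 3
      then have "b4 > 0" using 3 \<open>s < 0\<close> by (simp add: d mult_less_0_iff)
      moreover from this have "b0 < 0"
        using s' \<open>s < 0\<close> by (simp add: b0 mult_pos_neg mult_neg_pos)
      ultimately show ?thesis using gt by blast
    qed
  qed
qed

section \<open>Trigonometric form, absence of solitary waves, admissible coefficients\<close>

theorem theorem5p2:
  fixes a b :: "nat \<Rightarrow> real" and m n :: nat and T :: real
  assumes "m \<in> {1, 2, 3, 4}" and "n > 1" and "T > 0"
    and "(b 1)\<^sup>2 + (b 2)\<^sup>2 + (b 10)\<^sup>2 \<noteq> 0"
    and "at_most_one_classical_solution T m n a b"
  shows
    "(\<forall>v g c. classical_solution {0..T} m n a b v \<and> nontrivial {0..T} v \<and>
        bounded_function {0..T} v \<and> spatially_symmetric {0..T} v \<and> travels_with {0..T} v g c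
        \<longrightarrow> trigonometric_combination g)
     \<and> (\<nexists>v. classical_solution {0..T} m n a b v \<and> nontrivial {0..T} v \<and>
        spatially_symmetric {0..T} v \<and> steady {0..T} v \<and> solitary_type {0..T} v)
     \<and> ((\<exists>v. classical_solution {0..T} m n a b v \<and> nontrivial {0..T} v \<and>
           bounded_function {0..T} v \<and> spatially_symmetric {0..T} v \<and> steady {0..T} v)
        \<longrightarrow>
          (b 1 = 0 \<and> b 2 * b 10 > 0)
        \<or> ((b 2)\<^sup>2 > 4 * b 1 * b 10 \<and> b 1 < 0 \<and> b 10 > 0)
        \<or> ((b 2)\<^sup>2 > 4 * b 1 * b 10 \<and> (sqrt ((b 2)\<^sup>2 - 4 * b 1 * b 10) - b 2) * b 10 < 0)
        \<or> ((b 2)\<^sup>2 = 4 * b 1 * b 10 \<and> b 2 * b 10 > 0)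
        \<or> (b 10 = 0 \<and> b 2 \<noteq> 0 \<and> b 1 * b 2 > 0))"
proof (intro conjI allI impI notI)
  have nz: "b 1 \<noteq> 0 \<or> b 2 \<noteq> 0 \<or> b 10 \<noteq> 0"
    using assms(4) by auto
  note profile = symmetric_traveling_profile[OF _ assms(3) _ _ nz]
  have bounded_g: "bounded (range g)"
    if "bounded_function {0..T} v" "travels_with {0..T} v g c" for v g c
    using bounded_profile[OF that, of 0] assms(3) by simp
  {
    fix v g c
    assume *: "classical_solution {0..T} m n a b v \<and> nontrivial {0..T} v \<and>
        bounded_function {0..T} v \<and> spatially_symmetric {0..T} v \<and> travels_with {0..T} v g c"
    then obtain p \<alpha> \<beta> w z where "0 \<le> w" "0 \<le> z" "w \<noteq> z"
      "\<And>y. g y = \<alpha> * cos (w * (y - p)) + \<beta> * cos (z * (y - p))"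
      using profile(2)[of m n a v g c] bounded_g[of v g c] by blast
    then show "trigonometric_combination g"
      by (rule trigonometric_combination_two_cosines)
  next
    assume "\<exists>v. classical_solution {0..T} m n a b v \<and> nontrivial {0..T} v \<and>
        spatially_symmetric {0..T} v \<and> steady {0..T} v \<and> solitary_type {0..T} v"
    \<comment> \<open>The profile and speed are those of \<open>solitary_type\<close>, so that the
      profile is known to decay.\<close>
    then obtain v g c where v: "classical_solution {0..T} m n a b v" "nontrivial {0..T} v"
      "spatially_symmetric {0..T} v" "travels_with {0..T} v g c" and lim: "(g \<longlongrightarrow> 0) at_infinity"
      by (auto simp: solitary_type_def)
    have "bounded (range g)"
      by (rule bounded_range_of_tendsto_at_infinity[OF profile(1)[OF v(1,3,4)] lim])
    then obtain p \<alpha> \<beta> w z where wz: "0 \<le> w" "0 \<le> z" "w \<noteq> z"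
      and g: "\<And>y. g y = \<alpha> * cos (w * (y - p)) + \<beta> * cos (z * (y - p))"
      using profile(2)[OF v(1,3,4)] by blast
    have "(g \<longlongrightarrow> 0) at_top"
      using lim at_top_le_at_infinity by (rule tendsto_mono[rotated])
    from tendsto_at_top_shift[OF this, of p]
    have lim': "((\<lambda>y. \<alpha> * cos (w * y) + \<beta> * cos (z * y)) \<longlongrightarrow> 0) at_top"
      by (simp add: g)
    have "\<alpha> = 0"
      using two_cosines_tendsto_0[OF lim' wz] .
    \<comment> \<open>The same lemma with the two cosines exchanged.\<close>
    moreover have "\<beta> = 0"
      using two_cosines_tendsto_0[of \<beta> z \<alpha> w] lim' wz by (simp add: add.commute)
    ultimately show False
      using nontrivial_imp_profile_not_constant[OF v(2,4), of 0] by (simp add: g)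
  next
    assume "\<exists>v. classical_solution {0..T} m n a b v \<and> nontrivial {0..T} v \<and>
           bounded_function {0..T} v \<and> spatially_symmetric {0..T} v \<and> steady {0..T} v"
    then obtain v g c where v: "classical_solution {0..T} m n a b v" "nontrivial {0..T} v"
      "bounded_function {0..T} v" "spatially_symmetric {0..T} v" "travels_with {0..T} v g c"
      by (auto simp: steady_def)
    obtain p \<alpha> \<beta> w z where wz: "0 \<le> w" "0 \<le> z" "w \<noteq> z"
      and g: "\<And>y. g y = \<alpha> * cos (w * (y - p)) + \<beta> * cos (z * (y - p))"
      and root: "\<alpha> \<noteq> 0 \<longrightarrow> b 10 * w ^ 4 - b 2 * w\<^sup>2 + b 1 = 0"
        "\<beta> \<noteq> 0 \<longrightarrow> b 10 * z ^ 4 - b 2 * z\<^sup>2 + b 1 = 0"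
      using profile(2)[OF v(1,4,5) bounded_g[OF v(3,5)]] by blast
    \<comment> \<open>A non-constant profile has a mode with non-zero amplitude and non-zero
      frequency; its root condition gives \<open>x\<close> below.\<close>
    have "\<not> (\<alpha> * w = 0 \<and> \<beta> * z = 0)"
    proof
      assume "\<alpha> * w = 0 \<and> \<beta> * z = 0"
      then have "g y = \<alpha> + \<beta>" for y
        unfolding g by (intro arg_cong2[where f = "(+)"]) auto
      with nontrivial_imp_profile_not_constant[OF v(2,5)] show False by blast
    qed
    with root obtain x where x: "x \<noteq> 0" "b 10 * x ^ 4 - b 2 * x\<^sup>2 + b 1 = 0"
      by auto
    show "(b 1 = 0 \<and> b 2 * b 10 > 0)
        \<or> ((b 2)\<^sup>2 > 4 * b 1 * b 10 \<and> b 1 < 0 \<and> b 10 > 0)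
        \<or> ((b 2)\<^sup>2 > 4 * b 1 * b 10 \<and> (sqrt ((b 2)\<^sup>2 - 4 * b 1 * b 10) - b 2) * b 10 < 0)
        \<or> ((b 2)\<^sup>2 = 4 * b 1 * b 10 \<and> b 2 * b 10 > 0)
        \<or> (b 10 = 0 \<and> b 2 \<noteq> 0 \<and> b 1 * b 2 > 0)"
    proof (rule coefficient_conditions[OF _ _ nz])
      show "b 10 * (- x\<^sup>2)\<^sup>2 + b 2 * (- x\<^sup>2) + b 1 = 0"
        using x(2) by (simp flip: power_mult)
      show "- x\<^sup>2 < 0"
        using x(1) by simp
    qed
  }
qed

end
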